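(* Let $f_1,\dots,f_m:\mathbb{R}^n\to\mathbb{R}$ be continuous, let $g:\mathbb{R}^m\to\mathbb{R}$ be differentiable, and let $\phi$ be the functional on full-dimensional convex bodies in $\mathbb{R}^n$ given by $$\phi(K)=g\left(\int_Kf_1(x)\,dx,\dots,\int_Kf_m(x)\,dx\right).$$ Let $P\subset\mathbb{R}^n$ be a full-dimensional polytope and let $h_{\phi,P}:\mathbb{R}^n\to\mathbb{R}$ be defined by $$h_{\phi,P}=\sum_{i=1}^m\frac{\partial g}{\partial x_i}\left(\int_Pf_1(x)\,dx,\dots,\int_Pf_m(x)\,dx\right)\cdot f_i .$$ Let $\pi_{\mathsf{W}}$ denote the metric projection onto the closed convex cone $\mathsf{W}^2(P)$ in the Hilbert space $L^2(\mathrm{bd}\,P,\mathrm{vol}_\Phi)$. If $P$ is a local maximizer of $\phi$, then $\pi_{\mathsf{W}}(h_{\phi,P})=0\in L^2(\mathrm{bd}\,P,\mathrm{vol}_\Phi)$.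
   Context: A convex body is a non-empty compact convex subset of $\mathbb{R}^n$; the space of (full-dimensional) convex bodies carries the topology of the Hausdorff metric, and "local maximizer" refers to this topology. A polytope is the convex hull of a finite set; $\Phi(P)$ is the set of proper (non-empty) faces of $P$. A signed measure is a finite signed Borel measure on $\mathbb{R}^n$; $\mathsf{M}(X)$ is the space of signed measures supported on the Borel set $X$, i.e. vanishing on all Borel subsets of $\mathbb{R}^n\setminus X$. A family $(K_t)_{t\in[0,1]}$ of full-dimensional convex bodies is weakly differentiable if for every $f\in C(\mathbb{R}^n)$ the function $\phi_f(t)=\int_{K_t}f(x)\,dx$ is differentiable from the right at $t=0$; its weak derivative is $K_0'(f)=\frac{d}{dt}\phi_f(t)|_{t=0}$. $\mu\in\mathsf{M}(\mathrm{bd}\,K)$ is a small perturbation of $K$ if there is a weakly differentiable family with $K_0=K$ and $K_0'(f)=\int_{\mathrm{bd}\,K}f\,d\mu$ for all $f\in C(\mathbb{R}^n)$; $\mathsf{W}(K)$ is the set of small perturbations of $K$. For $F\in\Phi(P)$, $\mathrm{vol}_F$ is the restriction to $F$ of the Lebesgue measure on the affine hull of $F$ (unit point mass if $F$ is a vertex), and $\mathrm{vol}_\Phi=\sum_{F\in\Phi(P)}\mathrm{vol}_F$, a finite positive measure on $\mathrm{bd}\,P$. Finally, $$\mathsf{W}^2(P)=\{f\in L^2(\mathrm{bd}\,P,\mathrm{vol}_\Phi)\mid\text{there is }\mu\in\mathsf{W}(P)\text{ with } d\mu=f\,d\mathrm{vol}_\Phi\},$$ which is a closed convex cone in $L^2(\mathrm{bd}\,P,\mathrm{vol}_\Phi)$.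 The function $h_{\phi,P}$ is viewed as an element of this space by restriction to $\mathrm{bd}\,P$. *)

theory Defs
  imports "HOL-Analysis.Analysis"
begin

definition full_dim_convex_body :: "'a::euclidean_space set \<Rightarrow> bool" where
  "full_dim_convex_body K \<longleftrightarrow>
     K \<noteq> {} \<and> compact K \<and> convex K \<and> aff_dim K = int DIM('a)"

text \<open>The suprema are over bounded sets of reals, hence meaningful, when both arguments
  are non-empty and compact; it is only used for such sets.\<close>

definition hausdorff_dist :: "'a::metric_space set \<Rightarrow> 'a set \<Rightarrow> real" where
  "hausdorff_dist A B = max (SUP a\<in>A. infdist a B) (SUP b\<in>B. infdist b A)"

definition local_maximizer :: "('a::euclidean_space set \<Rightarrow> real) \<Rightarrow> 'a set \<Rightarrow> bool" where
  "local_maximizer \<phi> P \<longleftrightarrow> full_dim_convex_body P \<and>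
     (\<exists>\<epsilon>>0. \<forall>K. full_dim_convex_body K \<and> hausdorff_dist K P < \<epsilon> \<longrightarrow> \<phi> K \<le> \<phi> P)"

text \<open>A signed measure is a real-valued set function; its values on non-Borel sets are irrelevant.
  The series converges unconditionally, as every reordering of a disjoint family is again one.\<close>

definition signed_measure :: "('a::topological_space set \<Rightarrow> real) \<Rightarrow> bool" where
  "signed_measure \<mu> \<longleftrightarrow> \<mu> {} = 0 \<and>
     (\<forall>A::nat \<Rightarrow> 'a set. range A \<subseteq> sets borel \<and> disjoint_family A \<longrightarrow>
        (\<lambda>i. \<mu> (A i)) sums \<mu> (\<Union>i. A i))"

definition signed_measures_on :: "'a::topological_space set \<Rightarrow> ('a set \<Rightarrow> real) set" where
  "signed_measures_on X =
     {\<mu>. signed_measure \<mu> \<and> (\<forall>A\<in>sets borel. A \<subseteq> - X \<longrightarrow> \<mu> A = 0)}"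

text \<open>Jordan decomposition: the positive part of \<open>\<mu>\<close> is
  \<open>A \<mapsto> sup {\<mu> B | B \<subseteq> A Borel}\<close>, and the negative part is the positive part of \<open>- \<mu>\<close>.
  The truncation of negative values by \<open>ennreal\<close> is harmless because \<open>B = {}\<close> contributes 0.\<close>

definition pos_part :: "('a::topological_space set \<Rightarrow> real) \<Rightarrow> 'a measure" where
  "pos_part \<mu> =
     measure_of UNIV (sets borel) (\<lambda>A. SUP B\<in>{B \<in> sets borel. B \<subseteq> A}. ennreal (\<mu> B))"

definition neg_part :: "('a::topological_space set \<Rightarrow> real) \<Rightarrow> 'a measure" where
  "neg_part \<mu> = pos_part (\<lambda>A. - \<mu> A)"

definition signed_integral ::
    "('a::topological_space set \<Rightarrow> real) \<Rightarrow> 'a set \<Rightarrow> ('a \<Rightarrow> real) \<Rightarrow> real" where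
  "signed_integral \<mu> X f = (LINT x:X|pos_part \<mu>. f x) - (LINT x:X|neg_part \<mu>. f x)"

text \<open>A family indexed by \<open>[0,1]\<close> is a function on the reals whose values off \<open>[0,1]\<close> are
  irrelevant.\<close>

definition weakly_differentiable :: "(real \<Rightarrow> 'a::euclidean_space set) \<Rightarrow> bool" where
  "weakly_differentiable K \<longleftrightarrow>
     (\<forall>t\<in>{0..1}. full_dim_convex_body (K t)) \<and>
     (\<forall>f::'a \<Rightarrow> real. continuous_on UNIV f \<longrightarrow>
        (\<exists>D. ((\<lambda>t. LBINT x:K t. f x) has_real_derivative D) (at_right 0)))"

definition small_perturbations :: "'a::euclidean_space set \<Rightarrow> ('a set \<Rightarrow> real) set" where
  "small_perturbations K =
     {\<mu> \<in> signed_measures_on (frontier K).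
        \<exists>L. weakly_differentiable L \<and> L 0 = K \<and>
          (\<forall>f::'a \<Rightarrow> real. continuous_on UNIV f \<longrightarrow>
             ((\<lambda>t. LBINT x:L t. f x) has_real_derivative signed_integral \<mu> (frontier K) f)
               (at_right 0))}"

definition proper_faces :: "'a::euclidean_space set \<Rightarrow> 'a set set" where
  "proper_faces P = {F. F face_of P \<and> F \<noteq> {} \<and> F \<noteq> P}"

text \<open>Lebesgue measure on a non-empty affine subspace \<open>A\<close>, as a Borel measure on the whole space:
  the image of the product Lebesgue measure under the isometric parametrization
  \<open>c \<mapsto> a + (\<Sum>b\<in>B. c b *\<^sub>R b)\<close>, where \<open>a \<in> A\<close> and \<open>B\<close> is an orthonormal basis of the
  direction space of \<open>A\<close>. It does not depend on the choice of \<open>a\<close> and \<open>B\<close>. For \<open>A = {a}\<close> one has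
  \<open>B = {}\<close>, and the measure is the unit point mass at \<open>a\<close>.\<close>

definition orthonormal_basis :: "'a::euclidean_space set \<Rightarrow> 'a set \<Rightarrow> bool" where
  "orthonormal_basis V B \<longleftrightarrow>
     pairwise orthogonal B \<and> (\<forall>b\<in>B. norm b = 1) \<and> span B = V"

definition affine_lborel :: "'a::euclidean_space set \<Rightarrow> 'a measure" where
  "affine_lborel A =
     (let a = (SOME a. a \<in> A);
          B = (SOME B. orthonormal_basis ((\<lambda>x. x - a) ` A) B)
      in distr (\<Pi>\<^sub>M b\<in>B. lborel) borel (\<lambda>c. a + (\<Sum>b\<in>B. c b *\<^sub>R b)))"

definition vol_face :: "'a::euclidean_space set \<Rightarrow> 'a measure" where
  "vol_face F = density (affine_lborel (affine hull F)) (indicator F)"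

definition vol_Phi :: "'a::euclidean_space set \<Rightarrow> 'a measure" where
  "vol_Phi P = measure_of UNIV (sets borel) (\<lambda>A. \<Sum>F\<in>proper_faces P. emeasure (vol_face F) A)"

definition bd_vol :: "'a::euclidean_space set \<Rightarrow> 'a measure" where
  "bd_vol P = restrict_space (vol_Phi P) (frontier P)"

text \<open>\<open>L2 M\<close> consists of functions, not of equivalence classes; the element of the Hilbert space
  represented by \<open>f\<close> is \<open>L2_class M f\<close>.\<close>

definition L2 :: "'a measure \<Rightarrow> ('a \<Rightarrow> real) set" where
  "L2 M = {f \<in> borel_measurable M. integrable M (\<lambda>x. (f x)\<^sup>2)}"

definition L2_norm :: "'a measure \<Rightarrow> ('a \<Rightarrow> real) \<Rightarrow> real" where
  "L2_norm M f = sqrt (LINT x|M. (f x)\<^sup>2)"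

definition L2_class :: "'a measure \<Rightarrow> ('a \<Rightarrow> real) \<Rightarrow> ('a \<Rightarrow> real) set" where
  "L2_class M f = {g \<in> L2 M. AE x in M. g x = f x}"

text \<open>The metric projection of \<open>h\<close> onto \<open>C \<subseteq> L2 M\<close>, where \<open>C\<close> is closed under almost everywhere
  equality: the set of all points of \<open>C\<close> nearest to \<open>h\<close>. If these form a single element of the
  Hilbert space (as for \<open>C\<close> non-empty, closed and convex), this set is its equivalence class.
  An equation \<open>L2_proj M C h = L2_class M p\<close> with \<open>p \<in> L2 M\<close> thus says that \<open>p\<close> is the nearest
  point, and that it is unique up to almost everywhere equality.\<close>

definition L2_proj ::
    "'a measure \<Rightarrow> ('a \<Rightarrow> real) set \<Rightarrow> ('a \<Rightarrow> real) \<Rightarrow> ('a \<Rightarrow> real) set" where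
  "L2_proj M C h =
     {p \<in> C. \<forall>q\<in>C. L2_norm M (\<lambda>x. h x - p x) \<le> L2_norm M (\<lambda>x. h x - q x)}"

definition W2 :: "'a::euclidean_space set \<Rightarrow> ('a \<Rightarrow> real) set" where
  "W2 P = {f \<in> L2 (bd_vol P).
     \<exists>\<mu>\<in>small_perturbations P. \<forall>A\<in>sets borel. \<mu> A = (LINT x:A|bd_vol P. f x)}"

definition integrals :: "('m::finite \<Rightarrow> 'a::euclidean_space \<Rightarrow> real) \<Rightarrow> 'a set \<Rightarrow> real ^ 'm" where
  "integrals f K = (\<chi> i. LBINT x:K. f i x)"

definition partial_deriv :: "'m::finite \<Rightarrow> (real ^ 'm \<Rightarrow> real) \<Rightarrow> real ^ 'm \<Rightarrow> real" where
  "partial_deriv i g y = deriv (\<lambda>s. g (y + s *\<^sub>R axis i 1)) 0"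

definition phi_functional ::
    "(real ^ 'm::finite \<Rightarrow> real) \<Rightarrow> ('m \<Rightarrow> 'a::euclidean_space \<Rightarrow> real) \<Rightarrow> 'a set \<Rightarrow> real" where
  "phi_functional g f K = g (integrals f K)"

definition h_phi ::
    "(real ^ 'm::finite \<Rightarrow> real) \<Rightarrow> ('m \<Rightarrow> 'a::euclidean_space \<Rightarrow> real) \<Rightarrow> 'a set \<Rightarrow> 'a \<Rightarrow> real" where
  "h_phi g f P x = (\<Sum>i\<in>UNIV. partial_deriv i g (integrals f P) * f i x)"

end

theory Submission
  imports Defs
begin

text \<open>
  Write \<open>h\<close> for \<open>h_phi g f P\<close> and \<open>\<langle>u, v\<rangle>\<close> for the inner product of \<open>L2 (bd_vol P)\<close>. The theorem is a
  first-order optimality condition. Let \<open>w \<in> W2 P\<close> be the density of the derivative of a weakly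
  differentiable family \<open>L\<close> starting at \<open>P\<close>. By the chain rule the right derivative at \<open>0\<close> of
  \<open>\<phi> (L t)\<close> is \<open>\<langle>h, w\<rangle>\<close>. If the bodies \<open>L t\<close> tend to \<open>P\<close> in the Hausdorff metric, then local
  maximality makes this derivative nonpositive, so that \<open>h\<close> lies in the polar of \<open>W2 P\<close>
  (\<open>W2_inner_h_phi_nonpos\<close>).

  A point of the polar of a set that contains \<open>0\<close> has \<open>0\<close> as its unique nearest point in that set:
  \<open>\<parallel>h - q\<parallel>\<^sup>2 = \<parallel>h\<parallel>\<^sup>2 - 2 \<langle>h, q\<rangle> + \<parallel>q\<parallel>\<^sup>2 \<ge> \<parallel>h\<parallel>\<^sup>2 + \<parallel>q\<parallel>\<^sup>2\<close> (\<open>L2_proj_eq_zero_class\<close>).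

  Two ingredients need work. First, weak differentiability controls only integrals of continuous
  functions, and Hausdorff convergence has to be deduced from it; this is where convexity enters
  (\<open>weak_convergence_imp_hausdorff_convergence\<close>). Second, the integral against \<open>\<mu>\<close> is defined
  through its Jordan decomposition, and has to be identified with \<open>\<langle>h, w\<rangle>\<close> when \<open>\<mu>\<close> has density
  \<open>w\<close> (\<open>signed_integral_L2_density\<close>). This rests on the finiteness of \<open>bd_vol P\<close>, which also gives
  \<open>h \<in> L2 (bd_vol P)\<close>.
\<close>

section \<open>Weak convergence of convex bodies implies Hausdorff convergence\<close>

lemma full_dim_convex_body_interior:
  fixes K :: "'a::euclidean_space set"
  assumes "full_dim_convex_body K"
  shows "interior K \<noteq> {}" "closure (interior K) = K"
proof -
  have c: "convex K" "compact K" and d: "aff_dim K = int DIM('a)"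
    using assms by (auto simp: full_dim_convex_body_def)
  show i: "interior K \<noteq> {}"
    using d c(1) interior_rel_interior_gen[of K] rel_interior_eq_empty[of K] assms
    by (auto simp: full_dim_convex_body_def)
  show "closure (interior K) = K"
    using convex_closure_interior[OF c(1) i] c(2) by (simp add: compact_imp_closed)
qed

lemma integrable_on_compact:
  fixes f :: "'a::euclidean_space \<Rightarrow> real"
  assumes "compact K" "continuous_on UNIV f"
  shows "set_integrable lborel K f"
  using borel_integrable_compact[OF assms(1), of f] continuous_on_subset[OF assms(2)]
  unfolding set_integrable_def by (simp add: indicator_scaleR_eq_if)

text \<open>Convexity turns approximation into inclusion, at the price of half the radius: if \<open>K\<close> missed a
  point \<open>y\<close> of \<open>ball c r\<close>, a hyperplane through \<open>y\<close> would keep \<open>K\<close> on one side, and the point at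
  distance \<open>r\<close> from \<open>y\<close> on the other side would have no point of \<open>K\<close> closer than \<open>r\<close>.\<close>

lemma convex_near_ball_contains_half_ball:
  fixes K :: "'a::euclidean_space set"
  assumes "convex K" "closed K" "K \<noteq> {}"
    and near: "\<And>p. p \<in> ball c (2 * r) \<Longrightarrow> \<exists>k\<in>K. dist p k < r"
  shows "ball c r \<subseteq> K"
proof
  fix y assume y: "y \<in> ball c r"
  then have r: "r > 0" by (metis mem_ball zero_le_dist le_less_trans)
  show "y \<in> K"
  proof (rule ccontr)
    assume "y \<notin> K"
    obtain a b where ab: "inner a y < b" "\<And>k. k \<in> K \<Longrightarrow> inner a k > b"
      using separating_hyperplane_closed_point[OF assms(1,2) \<open>y \<notin> K\<close>] by blast
    have a0: "a \<noteq> 0"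
      using ab assms(3) by fastforce
    define u where "u = - sgn a"
    have nu: "norm u = 1" by (simp add: u_def norm_sgn a0)
    have "y + r *\<^sub>R u \<in> ball c (2 * r)"
    proof -
      have "dist c (y + r *\<^sub>R u) \<le> dist c y + dist y (y + r *\<^sub>R u)" by (rule dist_triangle)
      also have "dist y (y + r *\<^sub>R u) = r" using r nu by (simp add: dist_norm)
      finally show ?thesis using y by simp
    qed
    from near[OF this] obtain k where k: "k \<in> K" "dist (y + r *\<^sub>R u) k < r" by blast
    have au: "inner a u = - norm a"
      using a0 by (simp add: u_def sgn_div_norm dot_square_norm power2_eq_square)
    have "inner a (k - (y + r *\<^sub>R u)) \<le> norm a * norm (k - (y + r *\<^sub>R u))"
      by (rule norm_cauchy_schwarz)
    also have "\<dots> \<le> norm a * r"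
      using k(2) by (intro mult_left_mono) (auto simp: dist_norm norm_minus_commute)
    finally have "inner a k \<le> inner a y"
      using au by (simp add: inner_diff_right inner_add_right mult.commute)
    with ab(1) ab(2)[OF k(1)] show False by simp
  qed
qed

text \<open>Test against a bump function supported in \<open>ball p e\<close>. Its integral over \<open>P\<close> is positive, as a
  convex body is the closure of its interior; hence so are its integrals over \<open>K t\<close> eventually.\<close>

lemma weak_convergence_meets_ball:
  fixes K :: "'b \<Rightarrow> 'a::euclidean_space set"
  assumes P: "full_dim_convex_body P"
    and lim: "\<And>f::'a \<Rightarrow> real. continuous_on UNIV f \<Longrightarrow>
      ((\<lambda>t. LBINT x:K t. f x) \<longlongrightarrow> (LBINT x:P. f x)) F"
    and p: "p \<in> P" and e: "e > 0"
  shows "\<forall>\<^sub>F t in F. K t \<inter> ball p e \<noteq> {}"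
proof -
  define f where "f x = max 0 (e - dist p x)" for x
  have cf: "continuous_on UNIV f" unfolding f_def by (intro continuous_intros)
  have f0: "f x \<ge> 0" for x by (simp add: f_def)
  have "p \<in> closure (interior P)" using full_dim_convex_body_interior[OF P] p by simp
  then obtain q where q: "q \<in> interior P" "dist q p < e / 2"
    using e by (meson closure_approachable half_gt_zero)
  obtain d where d: "d > 0" "ball q d \<subseteq> P" using q(1) mem_interior by blast
  define r where "r = min d (e / 4)"
  have r: "r > 0" "ball q r \<subseteq> P" using d e by (auto simp: r_def)
  have lower: "e / 4 \<le> f x" if "x \<in> ball q r" for x
  proof -
    have "dist p x \<le> dist p q + dist q x" by (rule dist_triangle)
    with that q(2) have "e / 4 \<le> e - dist p x" by (auto simp: r_def dist_commute)
    then show ?thesis unfolding f_def by (rule max.coboundedI2)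
  qed
  have iP: "set_integrable lborel P f"
    using P cf by (intro integrable_on_compact) (auto simp: full_dim_convex_body_def)
  have "0 < measure lborel (ball q r) * (e / 4)"
    using r(1) e content_ball_pos[OF r(1), of q] by simp
  also have "\<dots> = (LBINT x:ball q r. e / 4)"
    using set_integral_const[of "ball q r" lborel "e/4"] emeasure_lborel_ball_finite[of q r]
    by (simp add: less_top)
  also have "\<dots> \<le> (LBINT x:P. f x)"
    unfolding set_lebesgue_integral_def
  proof (rule integral_mono)
    show "integrable lborel (\<lambda>x. indicat_real (ball q r) x *\<^sub>R (e / 4))"
      using emeasure_lborel_ball_finite[of q r] by (simp add: less_top)
    show "integrable lborel (\<lambda>x. indicat_real P x *\<^sub>R f x)"
      using iP by (simp add: set_integrable_def)
    fix x show "indicat_real (ball q r) x *\<^sub>R (e / 4) \<le> indicat_real P x *\<^sub>R f x"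
      using lower[of x] r(2) f0[of x] by (auto simp: indicator_def)
  qed
  finally have "0 < (LBINT x:P. f x)" .
  then have "\<forall>\<^sub>F t in F. 0 < (LBINT x:K t. f x)"
    using lim[OF cf] by (rule order_tendstoD(1)[rotated])
  then show ?thesis
  proof (rule eventually_mono)
    fix t assume t: "0 < (LBINT x:K t. f x)"
    show "K t \<inter> ball p e \<noteq> {}"
    proof
      assume "K t \<inter> ball p e = {}"
      then have "(\<lambda>x. indicat_real (K t) x *\<^sub>R f x) = (\<lambda>x. 0)"
        by (auto simp: indicator_def f_def fun_eq_iff)
      with t show False by (simp add: set_lebesgue_integral_def)
    qed
  qed
qed

text \<open>A finite net of \<open>P\<close> makes the preceding lemma uniform in the point.\<close>

lemma weak_convergence_approximates:
  fixes K :: "'b \<Rightarrow> 'a::euclidean_space set"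
  assumes P: "full_dim_convex_body P"
    and lim: "\<And>f::'a \<Rightarrow> real. continuous_on UNIV f \<Longrightarrow>
      ((\<lambda>t. LBINT x:K t. f x) \<longlongrightarrow> (LBINT x:P. f x)) F"
    and e: "e > 0"
  shows "\<forall>\<^sub>F t in F. \<forall>p\<in>P. \<exists>k\<in>K t. dist p k < e"
proof -
  have "compact P" using P by (simp add: full_dim_convex_body_def)
  then obtain N where N: "finite N" "N \<subseteq> P" "P \<subseteq> (\<Union>x\<in>N. ball x (e / 2))"
    using e compact_imp_seq_compact seq_compact_imp_totally_bounded by (metis half_gt_zero)
  have "\<forall>\<^sub>F t in F. \<forall>p\<in>N. K t \<inter> ball p (e / 2) \<noteq> {}"
    using weak_convergence_meets_ball[OF P lim] N e
    by (intro eventually_ball_finite) auto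
  then show ?thesis
  proof (rule eventually_mono, intro ballI)
    fix t p assume t: "\<forall>p\<in>N. K t \<inter> ball p (e / 2) \<noteq> {}" and p: "p \<in> P"
    from p N obtain q where q: "q \<in> N" "dist q p < e / 2" by auto
    from t q(1) have "K t \<inter> ball q (e / 2) \<noteq> {}" by blast
    then obtain k where k: "k \<in> K t" "dist q k < e / 2" by fastforce
    have "dist p k < e" using dist_triangle_half_r[OF q(2) k(2)] .
    with k show "\<exists>k\<in>K t. dist p k < e" by blast
  qed
qed

text \<open>The converse inclusion. A convex set that contains a fixed ball and a point far from \<open>P\<close> must
  contain a definite volume far from \<open>P\<close>, namely part of the cone from that point over the ball.
  The point \<open>x\<close> may be arbitrarily far away and the cone over it arbitrarily thin, so \<open>x\<close> is first
  replaced by a point \<open>y\<close> of the segment from \<open>c\<close> to \<open>x\<close> at distance exactly \<open>e\<close> from \<open>P\<close>. Shrinking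
  the ball towards \<open>y\<close> by the factor \<open>s\<close> keeps it at distance at least \<open>e / 2\<close> from \<open>P\<close>. The
  resulting bound is independent of \<open>K\<close> and \<open>x\<close>.\<close>

lemma protruding_point_mass:
  fixes K :: "'a::euclidean_space set"
  assumes K: "convex K" "compact K" and b: "ball c r \<subseteq> K" and r: "r > 0"
    and c: "c \<in> P" and bdd: "\<And>p. p \<in> P \<Longrightarrow> dist c p \<le> D"
    and P: "compact P"
    and e: "e > 0" and s: "0 < s" "s \<le> 1" "s * (D + e + r) \<le> e / 2"
    and x: "x \<in> K" "infdist x P > e"
  shows "measure lborel (ball (0::'a) (s * r)) * (e / 2) \<le> (LBINT x:K. infdist x P)"
proof -
  have cont: "continuous_on UNIV (\<lambda>x. infdist x P)"
    by (intro continuous_intros)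
  have "connected (closed_segment c x)" by simp
  moreover have "continuous_on (closed_segment c x) (\<lambda>x. infdist x P)"
    by (rule continuous_on_subset[OF cont]) simp
  ultimately have "connected ((\<lambda>x. infdist x P) ` closed_segment c x)"
    by (rule connected_continuous_image[rotated])
  moreover have "infdist c P \<in> (\<lambda>x. infdist x P) ` closed_segment c x"
    "infdist x P \<in> (\<lambda>x. infdist x P) ` closed_segment c x"
    by (rule imageI; simp)+
  moreover have "infdist c P \<le> e" "e \<le> infdist x P" using x c e by auto
  ultimately have "e \<in> (\<lambda>x. infdist x P) ` closed_segment c x"
    by (rule connectedD_interval)
  then obtain y where y: "y \<in> closed_segment c x" "infdist y P = e" by auto
  have "c \<in> K" using b r by auto
  then have yK: "y \<in> K" using y(1) x(1) K(1) closed_segment_subset by blast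
  have "P \<noteq> {}" using c by auto
  then obtain p where p: "p \<in> P" "dist y p = e"
    using infdist_attains_inf[of P y] y(2) P compact_imp_closed by metis
  have dc: "dist c y \<le> D + e"
    using dist_triangle[of c y p] bdd[OF p(1)] p(2) by (simp add: dist_commute)
  \<comment> \<open>The homothety with centre \<open>y\<close> and ratio \<open>s\<close> maps \<open>ball c r\<close> onto \<open>ball z (s * r)\<close>.\<close>
  define z where "z = y + s *\<^sub>R (c - y)"
  have sr: "s * r > 0" using s r by simp
  have sub: "ball z (s * r) \<subseteq> K"
  proof
    fix w assume w: "w \<in> ball z (s * r)"
    define v where "v = c + (1 / s) *\<^sub>R (w - z)"
    have "norm (w - z) < s * r" using w by (simp add: dist_norm norm_minus_commute)
    then have "(1 / s) * norm (w - z) < r"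
      using s(1) by (simp add: field_simps)
    then have "v \<in> ball c r" using s(1) by (simp add: v_def dist_norm)
    then have v: "v \<in> K" using b by blast
    have "w = (1 - s) *\<^sub>R y + s *\<^sub>R v"
      using s(1) by (simp add: v_def z_def algebra_simps)
    then show "w \<in> K" using convexD[OF K(1) yK v, of "1 - s" s] s by simp
  qed
  have far: "e / 2 \<le> infdist w P" if "w \<in> ball z (s * r)" for w
  proof -
    have "dist y w \<le> dist y z + dist z w" by (rule dist_triangle)
    also have "dist y z = s * dist c y" using s(1) by (simp add: z_def dist_norm)
    also have "\<dots> \<le> s * (D + e)" using dc s(1) by (intro mult_left_mono) auto
    finally have "dist y w \<le> s * (D + e) + s * r" using that by simp
    also have "\<dots> = s * (D + e + r)" by (simp add: algebra_simps)
    also have "\<dots> \<le> e / 2" by (rule s(3))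
    finally show ?thesis using infdist_triangle[of y P w] y(2) by simp
  qed
  have fin: "emeasure lborel (ball z (s * r)) < \<infinity>" by (rule emeasure_lborel_ball_finite)
  have "measure lborel (ball (0::'a) (s * r)) * (e / 2) = measure lborel (ball z (s * r)) * (e / 2)"
    using sr content_ball[of "s*r" z] content_ball[of "s*r" "0::'a"] by simp
  also have "\<dots> = (LBINT x:ball z (s * r). e / 2)"
    using set_integral_const[of "ball z (s*r)" lborel "e/2"] fin
    by (simp add: less_top)
  also have "\<dots> \<le> (LBINT x:K. infdist x P)"
    unfolding set_lebesgue_integral_def
  proof (rule integral_mono)
    show "integrable lborel (\<lambda>x. indicat_real (ball z (s * r)) x *\<^sub>R (e / 2))"
      using fin by (simp add: less_top)
    show "integrable lborel (\<lambda>x. indicat_real K x *\<^sub>R infdist x P)"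
      using integrable_on_compact[OF K(2) cont] by (simp add: set_integrable_def)
    fix x show "indicat_real (ball z (s * r)) x *\<^sub>R (e / 2) \<le> indicat_real K x *\<^sub>R infdist x P"
      using far[of x] sub infdist_nonneg[of x P] by (auto simp: indicator_def)
  qed
  finally show ?thesis .
qed

text \<open>Points of \<open>P\<close> are near \<open>K t\<close> by \<open>weak_convergence_approximates\<close>. For the other direction test
  against the distance to \<open>P\<close>, which integrates to \<open>0\<close> over \<open>P\<close>: its integral over \<open>K t\<close> becomes
  too small for \<open>K t\<close> to have a point protruding by more than \<open>e\<close>.\<close>

lemma weak_convergence_imp_hausdorff_convergence:
  fixes K :: "'b \<Rightarrow> 'a::euclidean_space set"
  assumes P: "full_dim_convex_body P"
    and K: "\<forall>\<^sub>F t in F. full_dim_convex_body (K t)"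
    and lim: "\<And>f::'a \<Rightarrow> real. continuous_on UNIV f \<Longrightarrow>
      ((\<lambda>t. LBINT x:K t. f x) \<longlongrightarrow> (LBINT x:P. f x)) F"
    and \<epsilon>: "\<epsilon> > 0"
  shows "\<forall>\<^sub>F t in F. hausdorff_dist (K t) P < \<epsilon>"
proof -
  define e where "e = \<epsilon> / 2"
  have e: "e > 0" using \<epsilon> by (simp add: e_def)
  have cP: "compact P" "P \<noteq> {}" using P by (auto simp: full_dim_convex_body_def)
  obtain c where "c \<in> interior P" using full_dim_convex_body_interior(1)[OF P] by blast
  then obtain r0 where r0: "r0 > 0" "ball c r0 \<subseteq> P" using mem_interior by blast
  \<comment> \<open>Half an inscribed radius, so that the ball of radius \<open>r\<close> eventually lies in \<open>K t\<close>.\<close>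
  define r where "r = r0 / 2"
  have r: "r > 0" "ball c (2 * r) \<subseteq> P" using r0 by (auto simp: r_def)
  have cinP: "c \<in> P" using r by auto
  have "bounded P" using cP by (simp add: compact_imp_bounded)
  then obtain D where D: "\<And>p. p \<in> P \<Longrightarrow> dist c p \<le> D"
    using bounded_any_center[of P c] by blast
  have D0: "D \<ge> 0" using D[OF cinP] by simp
  \<comment> \<open>The factor by which the ball is shrunk towards a protruding point; \<open>\<delta>\<close> bounds the integral of
    the distance to \<open>P\<close> that such a point would force.\<close>
  define s where "s = min 1 (e / 2 / (D + e + r))"
  have pos: "D + e + r > 0" using D0 e r by simp
  have s: "0 < s" "s \<le> 1" using pos e by (auto simp: s_def)
  have s3: "s * (D + e + r) \<le> e / 2"
    unfolding pos_le_divide_eq[OF pos, symmetric] by (simp add: s_def)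
  define \<delta> where "\<delta> = measure lborel (ball (0::'a) (s * r)) * (e / 2)"
  have \<delta>: "\<delta> > 0" unfolding \<delta>_def using s r e by (simp add: content_ball_pos)
  have cont: "continuous_on UNIV (\<lambda>x. infdist x P)"
    by (intro continuous_intros)
  have "(\<lambda>x. indicat_real P x *\<^sub>R infdist x P) = (\<lambda>x. 0)"
    by (auto simp: indicator_def fun_eq_iff)
  then have "(LBINT x:P. infdist x P) = 0" by (simp add: set_lebesgue_integral_def)
  then have "\<forall>\<^sub>F t in F. (LBINT x:K t. infdist x P) < \<delta>"
    using order_tendstoD(2)[OF lim[OF cont]] \<delta> by simp
  moreover have "\<forall>\<^sub>F t in F. \<forall>p\<in>P. \<exists>k\<in>K t. dist p k < e"
    "\<forall>\<^sub>F t in F. \<forall>p\<in>P. \<exists>k\<in>K t. dist p k < r"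
    using weak_convergence_approximates[OF P lim] e r(1) by blast+
  moreover note K
  ultimately show ?thesis
  proof eventually_elim
    case (elim t)
    have Kt: "K t \<noteq> {}" "compact (K t)" "convex (K t)"
      using elim(4) by (auto simp: full_dim_convex_body_def)
    have 1: "infdist p (K t) \<le> e" if "p \<in> P" for p
      using elim(2) that infdist_le2 by (metis less_imp_le)
    have bK: "ball c r \<subseteq> K t"
      using elim(3) r(2) Kt by (intro convex_near_ball_contains_half_ball) (auto simp: compact_imp_closed)
    have 2: "infdist x P \<le> e" if "x \<in> K t" for x
      using protruding_point_mass[OF Kt(3,2) bK r(1) cinP D cP(1) e s s3 that] elim(1)
      unfolding \<delta>_def by (meson not_le)
    have "hausdorff_dist (K t) P \<le> e"
      unfolding hausdorff_dist_def using 1 2 Kt(1) cP(2) by (intro max.boundedI cSUP_least) auto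
    then show ?case using \<epsilon> by (simp add: e_def)
  qed
qed

section \<open>Finiteness of the boundary measure\<close>

text \<open>In the orthonormal coordinates that define \<open>affine_lborel\<close>, a bounded set lies in a box.\<close>

lemma vol_face_finite:
  fixes F :: "'a::euclidean_space set"
  assumes F: "compact F" "F \<noteq> {}"
  shows "emeasure (vol_face F) UNIV < \<infinity>"
proof -
  define A where "A = affine hull F"
  define a where "a = (SOME a. a \<in> A)"
  define B where "B = (SOME B. orthonormal_basis ((\<lambda>x. x - a) ` A) B)"
  define p where "p c = a + (\<Sum>b\<in>B. c b *\<^sub>R b)" for c :: "'a \<Rightarrow> real"
  have "A \<noteq> {}" using F(2) by (simp add: A_def)
  then have "a \<in> A" unfolding a_def by (metis ex_in_conv someI)
  then have "subspace ((\<lambda>x. x - a) ` A)"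
    by (intro affine_diffs_subspace_subtract) (auto simp: A_def)
  then have "\<exists>B. orthonormal_basis ((\<lambda>x. x - a) ` A) B"
    unfolding orthonormal_basis_def by (metis orthonormal_basis_subspace)
  then have B: "pairwise orthogonal B" "\<And>b. b \<in> B \<Longrightarrow> norm b = 1"
    unfolding B_def[symmetric] using someI_ex[of "orthonormal_basis ((\<lambda>x. x - a) ` A)"]
    by (auto simp: B_def orthonormal_basis_def)
  have "0 \<notin> B" using B(2)[of 0] by auto
  then have "independent B" using B(1) by (intro pairwise_orthogonal_independent)
  then have finB: "finite B" using independent_bound by blast
  have eq: "affine_lborel A = distr (\<Pi>\<^sub>M b\<in>B. lborel) borel p"
    unfolding affine_lborel_def Let_def a_def[symmetric] B_def[symmetric] p_def by simp
  have p[measurable]: "p \<in> (\<Pi>\<^sub>M b\<in>B. lborel) \<rightarrow>\<^sub>M borel"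
    unfolding p_def by measurable
  have coord: "(p c - a) \<bullet> b = c b" if "b \<in> B" for c b
  proof -
    have "(p c - a) \<bullet> b = (\<Sum>b'\<in>B. c b' * (b' \<bullet> b))"
      by (simp add: p_def inner_sum_left)
    also have "\<dots> = (\<Sum>b'\<in>B. if b' = b then c b else 0)"
      using B that by (intro sum.cong) (auto simp: pairwise_def orthogonal_def dot_square_norm)
    also have "\<dots> = c b" using finB that by simp
    finally show ?thesis .
  qed
  obtain R where R: "\<And>x. x \<in> F \<Longrightarrow> dist a x \<le> R"
    using F(1) compact_imp_bounded bounded_any_center by metis
  have Fb[measurable]: "F \<in> sets borel" using F(1) by (simp add: borel_compact)
  interpret product_sigma_finite "\<lambda>b::'a. lborel :: real measure" ..
  have "emeasure (vol_face F) UNIV = (\<integral>\<^sup>+x. indicator F x \<partial>affine_lborel A)"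
    unfolding vol_face_def A_def[symmetric]
    by (subst emeasure_density) (auto simp: eq)
  also have "\<dots> = emeasure (affine_lborel A) F" by (simp add: eq)
  also have "\<dots> = emeasure (\<Pi>\<^sub>M b\<in>B. lborel) (p -` F \<inter> space (\<Pi>\<^sub>M b\<in>B. lborel))"
    unfolding eq by (rule emeasure_distr) measurable
  also have "\<dots> \<le> emeasure (\<Pi>\<^sub>M b\<in>B. lborel) (\<Pi>\<^sub>E b\<in>B. {-R..R})"
  proof (rule emeasure_mono)
    show "p -` F \<inter> space (\<Pi>\<^sub>M b\<in>B. lborel) \<subseteq> (\<Pi>\<^sub>E b\<in>B. {-R..R})"
    proof
      fix c assume c: "c \<in> p -` F \<inter> space (\<Pi>\<^sub>M b\<in>B. lborel)"
      have "c b \<in> {-R..R}" if b: "b \<in> B" for b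
      proof -
        have "\<bar>c b\<bar> \<le> norm (p c - a) * norm b"
          using Cauchy_Schwarz_ineq2[of "p c - a" b] coord[OF b] by simp
        also have "\<dots> \<le> R" using R[of "p c"] c B(2)[OF b]
          by (simp add: dist_norm norm_minus_commute)
        finally show ?thesis by auto
      qed
      then show "c \<in> (\<Pi>\<^sub>E b\<in>B. {-R..R})"
        using c by (auto simp: space_PiM PiE_iff)
    qed
    show "(\<Pi>\<^sub>E b\<in>B. {-R..R}) \<in> sets (\<Pi>\<^sub>M b\<in>B. lborel)"
      using finB by (intro sets_PiM_I_finite) auto
  qed
  also have "\<dots> = (\<Prod>b\<in>B. emeasure lborel {-R..R})"
    using finB by (intro emeasure_PiM) auto
  also have "\<dots> < \<infinity>"
    by (simp add: emeasure_lborel_Icc_eq power_less_top_ennreal)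
  finally show ?thesis .
qed

lemma sets_vol_face [simp]: "sets (vol_face F) = sets borel"
  by (simp add: vol_face_def affine_lborel_def Let_def)

lemma sets_vol_Phi [simp, measurable_cong]: "sets (vol_Phi P) = sets borel"
  unfolding vol_Phi_def
  by (metis sets.sigma_sets_eq sets_measure_of space_borel sets.space_closed)

lemma space_vol_Phi [simp]: "space (vol_Phi P) = UNIV"
  using sets_eq_imp_space_eq[OF sets_vol_Phi] by simp

lemma emeasure_vol_Phi:
  assumes "A \<in> sets borel"
  shows "emeasure (vol_Phi P) A = (\<Sum>F\<in>proper_faces P. emeasure (vol_face F) A)"
proof (rule emeasure_measure_of)
  show "vol_Phi P =
    measure_of UNIV (sets borel) (\<lambda>A. \<Sum>F\<in>proper_faces P. emeasure (vol_face F) A)"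
    by (rule vol_Phi_def)
  show "countably_additive (sets (vol_Phi P)) (\<lambda>A. \<Sum>F\<in>proper_faces P. emeasure (vol_face F) A)"
  proof (rule countably_additiveI)
    fix S :: "nat \<Rightarrow> 'a set"
    assume S: "range S \<subseteq> sets (vol_Phi P)" "disjoint_family S"
    have "(\<Sum>i. \<Sum>F\<in>proper_faces P. emeasure (vol_face F) (S i)) =
      (\<Sum>F\<in>proper_faces P. \<Sum>i. emeasure (vol_face F) (S i))"
      by (rule suminf_sum) simp
    also have "\<dots> = (\<Sum>F\<in>proper_faces P. emeasure (vol_face F) (\<Union>i. S i))"
      using S by (intro sum.cong refl suminf_emeasure) auto
    finally show "(\<Sum>i. \<Sum>F\<in>proper_faces P. emeasure (vol_face F) (S i)) =
      (\<Sum>F\<in>proper_faces P. emeasure (vol_face F) (\<Union>i. S i))" .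
  qed
qed (use assms in \<open>auto simp: positive_def\<close>)

lemma finite_measure_vol_Phi:
  assumes "polytope P"
  shows "finite_measure (vol_Phi P)"
proof
  have fin: "finite (proper_faces P)"
    unfolding proper_faces_def by (rule finite_subset[OF _ finite_polytope_faces[OF assms]]) auto
  have "emeasure (vol_face F) UNIV < \<infinity>" if "F \<in> proper_faces P" for F
    using that assms
    by (intro vol_face_finite)
      (auto simp: proper_faces_def intro: polytope_imp_compact face_of_polytope_polytope)
  then show "emeasure (vol_Phi P) (space (vol_Phi P)) \<noteq> \<infinity>"
    using fin by (simp add: emeasure_vol_Phi less_top)
qed

section \<open>Signed measures given by densities\<close>

text \<open>The supremum that defines the positive part is attained at \<open>B = A \<inter> {x. 0 < w x}\<close>. The density
  on the right is the positive part of \<open>w\<close>, since \<open>ennreal\<close> sends negative numbers to \<open>0\<close>.\<close>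

lemma pos_part_eq_density:
  fixes w :: "'a::topological_space \<Rightarrow> real"
  assumes M[measurable_cong]: "sets M = sets borel" and w: "integrable M w"
    and \<mu>: "\<And>A. A \<in> sets borel \<Longrightarrow> \<mu> A = (LINT x:A|M. w x)"
  shows "pos_part \<mu> = density M (\<lambda>x. ennreal (w x))"
proof -
  note [measurable] = borel_measurable_integrable[OF w]
  have sp: "space M = UNIV" using sets_eq_imp_space_eq[OF M] by simp
  have "(SUP B\<in>{B \<in> sets borel. B \<subseteq> A}. ennreal (\<mu> B)) = emeasure (density M (\<lambda>x. ennreal (w x))) A"
    if A[measurable]: "A \<in> sets borel" for A
  proof -
    define w' where "w' x = indicator A x * max 0 (w x)" for x
    have iw': "integrable M w'"
      unfolding w'_def using integrable_real_mult_indicator[of A M "\<lambda>x. max 0 (w x)"] w A M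
      by (simp add: mult.commute)
    have "emeasure (density M (\<lambda>x. ennreal (w x))) A = (\<integral>\<^sup>+x. ennreal (w' x) \<partial>M)"
      by (subst emeasure_density)
        (auto simp: w'_def indicator_def M ennreal_max_0 intro!: nn_integral_cong)
    also have "\<dots> = ennreal (LINT x|M. w' x)"
      by (rule nn_integral_eq_integral[OF iw']) (simp add: w'_def)
    finally have e: "emeasure (density M (\<lambda>x. ennreal (w x))) A = ennreal (LINT x|M. w' x)" .
    show ?thesis
      unfolding e
    proof (rule SUP_eqI)
      fix B assume "B \<in> {B \<in> sets borel. B \<subseteq> A}"
      then have B[measurable]: "B \<in> sets borel" and BA: "B \<subseteq> A" by auto
      have "\<mu> B \<le> (LINT x|M. w' x)"
        unfolding \<mu>[OF B] set_lebesgue_integral_def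
      proof (rule integral_mono)
        show "integrable M (\<lambda>x. indicat_real B x *\<^sub>R w x)"
          using w B M by (intro integrable_mult_indicator) auto
        show "indicat_real B x *\<^sub>R w x \<le> w' x" for x
          using BA by (auto simp: w'_def indicator_def)
      qed (rule iw')
      then show "ennreal (\<mu> B) \<le> ennreal (LINT x|M. w' x)" by (rule ennreal_leI)
    next
      fix y assume y: "\<And>B. B \<in> {B \<in> sets borel. B \<subseteq> A} \<Longrightarrow> ennreal (\<mu> B) \<le> y"
      define B where "B = A \<inter> {x \<in> space M. 0 < w x}"
      have "B \<in> sets M" unfolding B_def by measurable
      then have B: "B \<in> sets borel" using M by simp
      have "\<mu> B = (LINT x|M. w' x)"
        unfolding \<mu>[OF B] set_lebesgue_integral_def
        by (rule Bochner_Integration.integral_cong) (auto simp: w'_def B_def indicator_def sp)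
      then show "ennreal (LINT x|M. w' x) \<le> y" using y[of B] B by (auto simp: B_def)
    qed
  qed
  then have "pos_part \<mu> = measure_of UNIV (sets borel) (emeasure (density M (\<lambda>x. ennreal (w x))))"
    unfolding pos_part_def
    by (intro measure_of_eq) (auto simp: sets.sigma_sets_eq[of borel, simplified])
  also have "\<dots> = density M (\<lambda>x. ennreal (w x))"
    using measure_of_of_measure[of "density M (\<lambda>x. ennreal (w x))"] by (simp add: M sp)
  finally show ?thesis .
qed

lemma signed_integral_eq_integral_density:
  fixes w h :: "'a::euclidean_space \<Rightarrow> real"
  assumes M[measurable_cong]: "sets M = sets borel" and w: "integrable M w"
    and \<mu>: "\<And>A. A \<in> sets borel \<Longrightarrow> \<mu> A = (LINT x:A|M. w x)"
    and X: "compact X" and h: "continuous_on UNIV h"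
  shows "signed_integral \<mu> X h = (LINT x:X|M. h x * w x)"
proof -
  note [measurable] = borel_measurable_integrable[OF w]
  have [measurable]: "h \<in> borel_measurable borel" using h by (rule borel_measurable_continuous_onI)
  have [measurable]: "X \<in> sets borel" using X by (simp add: borel_compact)
  have "bounded (h ` X)"
    using X h by (intro compact_imp_bounded compact_continuous_image) (auto intro: continuous_on_subset)
  then obtain C where C: "\<And>x. x \<in> X \<Longrightarrow> \<bar>h x\<bar> \<le> C" unfolding bounded_iff by auto
  have int: "integrable M (\<lambda>x. v x * (indicator X x * h x))"
    if "v \<in> borel_measurable M" "\<And>x. \<bar>v x\<bar> \<le> \<bar>w x\<bar>" for v :: "'a \<Rightarrow> real"
  proof (rule Bochner_Integration.integrable_bound)
    show "integrable M (\<lambda>x. C * w x)" using w by simp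
    show "(\<lambda>x. v x * (indicator X x * h x)) \<in> borel_measurable M"
      using that(1) by measurable
    show "AE x in M. norm (v x * (indicator X x * h x)) \<le> norm (C * w x)"
    proof (rule AE_I2)
      fix x
      show "norm (v x * (indicator X x * h x)) \<le> norm (C * w x)"
      proof (cases "x \<in> X")
        case True
        have "\<bar>h x\<bar> * \<bar>v x\<bar> \<le> \<bar>C\<bar> * \<bar>w x\<bar>"
          using C[OF True] that(2)[of x] by (intro mult_mono) auto
        then show ?thesis using True by (simp add: abs_mult mult.commute)
      qed simp
    qed
  qed
  have ip: "integrable M (\<lambda>x. max 0 (w x) * (indicator X x * h x))"
    by (rule int) auto
  have im: "integrable M (\<lambda>x. max 0 (- w x) * (indicator X x * h x))"
    by (rule int) auto
  \<comment> \<open>The density must be nonnegative for the integral to be pulled back to \<open>M\<close>.\<close>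
  have pos: "pos_part \<mu> = density M (\<lambda>x. ennreal (max 0 (w x)))"
    using pos_part_eq_density[OF M w \<mu>] by (simp add: ennreal_max_0)
  have neg: "neg_part \<mu> = density M (\<lambda>x. ennreal (max 0 (- w x)))"
    unfolding neg_part_def
    using pos_part_eq_density[OF M, of "\<lambda>x. - w x" "\<lambda>A. - \<mu> A"] w \<mu>
    by (simp add: ennreal_max_0 set_lebesgue_integral_def)
  have "signed_integral \<mu> X h =
    (LINT x|M. max 0 (w x) * (indicator X x * h x)) - (LINT x|M. max 0 (- w x) * (indicator X x * h x))"
    unfolding signed_integral_def pos neg set_lebesgue_integral_def
    by (subst (1 2) integral_density) auto
  also have "\<dots> = (LINT x|M. max 0 (w x) * (indicator X x * h x) - max 0 (- w x) * (indicator X x * h x))"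
    using ip im by simp
  also have "\<dots> = (LINT x:X|M. h x * w x)"
    unfolding set_lebesgue_integral_def
    by (rule Bochner_Integration.integral_cong) (auto simp: max_def)
  finally show "signed_integral \<mu> X h = (LINT x:X|M. h x * w x)" .
qed

section \<open>Projection of a point of the polar\<close>

lemma L2_mult_integrable:
  assumes "u \<in> L2 M" "v \<in> L2 M"
  shows "integrable M (\<lambda>x. u x * v x)"
proof (rule Bochner_Integration.integrable_bound)
  show "integrable M (\<lambda>x. (u x)\<^sup>2 + (v x)\<^sup>2)" using assms by (simp add: L2_def)
  show "(\<lambda>x. u x * v x) \<in> borel_measurable M" using assms by (auto simp: L2_def)
  have "\<bar>u x * v x\<bar> \<le> (u x)\<^sup>2 + (v x)\<^sup>2" for x
  proof -
    have "2 * (\<bar>u x\<bar> * \<bar>v x\<bar>) \<le> (u x)\<^sup>2 + (v x)\<^sup>2"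
      using sum_squares_bound[of "\<bar>u x\<bar>" "\<bar>v x\<bar>"] by simp
    moreover have "0 \<le> \<bar>u x\<bar> * \<bar>v x\<bar>" by simp
    ultimately show ?thesis unfolding abs_mult by linarith
  qed
  then show "AE x in M. norm (u x * v x) \<le> norm ((u x)\<^sup>2 + (v x)\<^sup>2)" by simp
qed

lemma L2_norm_diff_sq:
  assumes "u \<in> L2 M" "v \<in> L2 M"
  shows "(L2_norm M (\<lambda>x. u x - v x))\<^sup>2 =
    (LINT x|M. (u x)\<^sup>2) - 2 * (LINT x|M. u x * v x) + (LINT x|M. (v x)\<^sup>2)"
proof -
  have i: "integrable M (\<lambda>x. (u x)\<^sup>2)" "integrable M (\<lambda>x. (v x)\<^sup>2)"
    "integrable M (\<lambda>x. u x * v x)"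
    using assms L2_mult_integrable[OF assms] by (auto simp: L2_def)
  have "(L2_norm M (\<lambda>x. u x - v x))\<^sup>2 = (LINT x|M. (u x - v x)\<^sup>2)"
    by (simp add: L2_norm_def)
  also have "\<dots> = (LINT x|M. (u x)\<^sup>2 - 2 * (u x * v x) + (v x)\<^sup>2)"
    by (rule Bochner_Integration.integral_cong) (auto simp: power2_diff)
  finally show ?thesis using i by simp
qed

text \<open>For \<open>q \<in> C\<close> the hypothesis gives \<open>\<parallel>h - q\<parallel>\<^sup>2 \<ge> \<parallel>h\<parallel>\<^sup>2 + \<parallel>q\<parallel>\<^sup>2\<close>. Hence \<open>0\<close> is a nearest point, and
  any nearest point has norm \<open>0\<close>.\<close>

lemma L2_proj_eq_zero_class:
  assumes C: "C \<subseteq> L2 M" and zero: "L2_class M (\<lambda>x. 0) \<subseteq> C" and h: "h \<in> L2 M"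
    and polar: "\<And>q. q \<in> C \<Longrightarrow> (LINT x|M. h x * q x) \<le> 0"
  shows "L2_proj M C h = L2_class M (\<lambda>x. 0)"
proof (intro set_eqI iffI)
  fix p assume p: "p \<in> L2_class M (\<lambda>x. 0)"
  then have p0: "p \<in> L2 M" "AE x in M. p x = 0" by (auto simp: L2_class_def)
  have "(LINT x|M. h x * p x) = 0" "(LINT x|M. (p x)\<^sup>2) = 0"
    using p0 by (auto intro!: integral_eq_zero_AE)
  then have np: "(L2_norm M (\<lambda>x. h x - p x))\<^sup>2 = (LINT x|M. (h x)\<^sup>2)"
    using L2_norm_diff_sq[OF h p0(1)] by simp
  have "L2_norm M (\<lambda>x. h x - p x) \<le> L2_norm M (\<lambda>x. h x - q x)" if q: "q \<in> C" for q
  proof (rule power2_le_imp_le)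
    have "0 \<le> (LINT x|M. (q x)\<^sup>2)" by simp
    moreover have "q \<in> L2 M" using C q by auto
    ultimately show "(L2_norm M (\<lambda>x. h x - p x))\<^sup>2 \<le> (L2_norm M (\<lambda>x. h x - q x))\<^sup>2"
      using np L2_norm_diff_sq[OF h, of q] polar[OF q] by linarith
  qed (simp add: L2_norm_def)
  then show "p \<in> L2_proj M C h" using p zero by (auto simp: L2_proj_def)
next
  fix p assume "p \<in> L2_proj M C h"
  then have p: "p \<in> C" "\<And>q. q \<in> C \<Longrightarrow> L2_norm M (\<lambda>x. h x - p x) \<le> L2_norm M (\<lambda>x. h x - q x)"
    by (auto simp: L2_proj_def)
  have pL: "p \<in> L2 M" using p C by auto
  have z: "(\<lambda>x. 0) \<in> L2 M" "(\<lambda>x. 0) \<in> C" using zero by (auto simp: L2_def L2_class_def)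
  have "(L2_norm M (\<lambda>x. h x - p x))\<^sup>2 \<le> (L2_norm M (\<lambda>x. h x - 0))\<^sup>2"
    using p(2)[OF z(2)] by (intro power_mono) (auto simp: L2_norm_def)
  then have "(LINT x|M. (p x)\<^sup>2) \<le> 0"
    using L2_norm_diff_sq[OF h pL] L2_norm_diff_sq[OF h z(1)] polar[OF p(1)] by simp
  then have "(LINT x|M. (p x)\<^sup>2) = 0" by (simp add: antisym)
  then have "AE x in M. p x = 0"
    using pL integral_nonneg_eq_0_iff_AE[of M "\<lambda>x. (p x)\<^sup>2"] by (auto simp: L2_def)
  then show "p \<in> L2_class M (\<lambda>x. 0)" using pL by (simp add: L2_class_def)
qed

section \<open>Right derivatives of the functional\<close>

lemma partial_deriv_eq:
  assumes "(g has_derivative g') (at y)"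
  shows "partial_deriv i g y = g' (axis i 1)"
proof -
  have g: "(g has_derivative g') (at (y + 0 *\<^sub>R axis i (1::real)))" using assms by simp
  have "((\<lambda>s. g (y + s *\<^sub>R axis i 1)) has_derivative (\<lambda>s. g' (s *\<^sub>R axis i 1))) (at (0::real))"
    by (rule has_derivative_compose[where f = "\<lambda>s. y + s *\<^sub>R axis i 1" and x = 0, OF _ g])
      (auto intro!: derivative_eq_intros)
  moreover have "g' (s *\<^sub>R axis i 1) = g' (axis i 1) * s" for s
    using linear_cmul[OF has_derivative_linear[OF assms]] by simp
  ultimately have "((\<lambda>s. g (y + s *\<^sub>R axis i 1)) has_field_derivative g' (axis i 1)) (at 0)"
    by (simp add: has_field_derivative_def)
  then show ?thesis unfolding partial_deriv_def by (rule DERIV_imp_deriv)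
qed

lemma phi_functional_has_derivative:
  fixes f :: "'m::finite \<Rightarrow> 'a::euclidean_space \<Rightarrow> real"
  assumes g: "g differentiable (at (integrals f (L t)))"
    and D: "\<And>i. ((\<lambda>t. LBINT x:L t. f i x) has_real_derivative D i) (at t within S)"
  shows "((\<lambda>t. phi_functional g f (L t)) has_real_derivative
    (\<Sum>i\<in>UNIV. partial_deriv i g (integrals f (L t)) * D i)) (at t within S)"
proof -
  obtain g' where g': "(g has_derivative g') (at (integrals f (L t)))"
    using g by (auto simp: differentiable_def)
  have sum: "integrals f K = (\<Sum>i\<in>UNIV. (LBINT x:K. f i x) *\<^sub>R axis i 1)" for K
    by (simp add: integrals_def vec_eq_iff axis_def if_distrib cong: if_cong)
  have "((\<lambda>t. integrals f (L t)) has_derivative (\<lambda>s. \<Sum>i\<in>UNIV. (D i * s) *\<^sub>R axis i 1))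
      (at t within S)"
    unfolding sum
    using D by (intro has_derivative_sum has_derivative_scaleR_left)
      (simp add: has_field_derivative_def)
  then have "((\<lambda>t. g (integrals f (L t))) has_derivative
      (\<lambda>s. g' (\<Sum>i\<in>UNIV. (D i * s) *\<^sub>R axis i 1))) (at t within S)"
    using g' by (rule has_derivative_compose)
  moreover have "g' (\<Sum>i\<in>UNIV. (D i * s) *\<^sub>R axis i 1) =
      (\<Sum>i\<in>UNIV. partial_deriv i g (integrals f (L t)) * D i) * s" for s
    using has_derivative_linear[OF g']
    by (simp add: linear_sum linear_cmul partial_deriv_eq[OF g'] sum_distrib_right mult_ac)
  ultimately show ?thesis by (simp add: has_field_derivative_def phi_functional_def)
qed


section \<open>The inner product with a small perturbation\<close>

lemma integral_bd_vol:
  shows "integrable (bd_vol P) u \<longleftrightarrow> integrable (vol_Phi P) (\<lambda>x. indicator (frontier P) x * u x)"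
    and "(LINT x|bd_vol P. u x) = (LINT x|vol_Phi P. indicator (frontier P) x * (u x :: real))"
proof -
  have "frontier P \<in> sets borel" by simp
  then show "integrable (bd_vol P) u \<longleftrightarrow> integrable (vol_Phi P) (\<lambda>x. indicator (frontier P) x * u x)"
    "(LINT x|bd_vol P. u x) = (LINT x|vol_Phi P. indicator (frontier P) x * u x)"
    unfolding bd_vol_def by (simp_all add: integrable_restrict_space integral_restrict_space)
qed

lemma space_bd_vol [simp]: "space (bd_vol P) = frontier P"
  by (simp add: bd_vol_def space_restrict_space)

lemma finite_measure_bd_vol:
  assumes "polytope P"
  shows "finite_measure (bd_vol P)"
proof -
  interpret finite_measure "vol_Phi P" by (rule finite_measure_vol_Phi[OF assms])
  show ?thesis
    unfolding bd_vol_def by (rule finite_measure_restrict_space) (auto intro: finite_measure_axioms)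
qed

lemma continuous_in_L2_bd_vol:
  assumes P: "polytope P" and h: "continuous_on UNIV h"
  shows "h \<in> L2 (bd_vol P)"
proof -
  interpret finite_measure "bd_vol P" by (rule finite_measure_bd_vol[OF P])
  have [measurable]: "h \<in> borel_measurable (bd_vol P)"
    unfolding bd_vol_def
    by (rule measurable_restrict_space1)
      (simp add: borel_measurable_continuous_onI[OF h] cong: measurable_cong_sets)
  have "compact (frontier P)" using polytope_imp_compact[OF P] by (rule compact_frontier)
  then have "bounded (h ` frontier P)"
    using h by (intro compact_imp_bounded compact_continuous_image) (auto intro: continuous_on_subset)
  then obtain C where C: "\<And>x. x \<in> frontier P \<Longrightarrow> \<bar>h x\<bar> \<le> C" unfolding bounded_iff by auto
  have "integrable (bd_vol P) (\<lambda>x. (h x)\<^sup>2)"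
  proof (rule integrable_const_bound)
    show "AE x in bd_vol P. norm ((h x)\<^sup>2) \<le> C\<^sup>2"
      using power_mono[OF C, of _ 2] by (intro AE_I2) simp
  qed measurable
  then show ?thesis by (simp add: L2_def)
qed

text \<open>The measure \<open>bd_vol P\<close> lives on the subspace \<open>frontier P\<close>, whereas \<open>signed_integral\<close> concerns Borel
  measures on the whole space; therefore \<open>w\<close> is extended by \<open>0\<close> to a density with respect to
  \<open>vol_Phi P\<close>. It is integrable because the measure is finite.\<close>

lemma signed_integral_L2_density:
  fixes h :: "'a::euclidean_space \<Rightarrow> real"
  assumes P: "polytope P" and w: "w \<in> L2 (bd_vol P)"
    and \<mu>: "\<And>A. A \<in> sets borel \<Longrightarrow> \<mu> A = (LINT x:A|bd_vol P. w x)"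
    and h: "continuous_on UNIV h"
  shows "signed_integral \<mu> (frontier P) h = (LINT x|bd_vol P. h x * w x)"
proof -
  have "(\<lambda>x. 1) \<in> L2 (bd_vol P)" by (rule continuous_in_L2_bd_vol[OF P]) simp
  from L2_mult_integrable[OF this w] have "integrable (bd_vol P) w" by simp
  then have iw: "integrable (vol_Phi P) (\<lambda>x. indicator (frontier P) x * w x)"
    by (simp add: integral_bd_vol)
  have "signed_integral \<mu> (frontier P) h =
    (LINT x:frontier P|vol_Phi P. h x * (indicator (frontier P) x * w x))"
  proof (rule signed_integral_eq_integral_density[OF _ iw _ _ h])
    show "compact (frontier P)" using polytope_imp_compact[OF P] by (rule compact_frontier)
    show "\<mu> A = (LINT x:A|vol_Phi P. indicator (frontier P) x * w x)" if "A \<in> sets borel" for A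
      unfolding \<mu>[OF that] set_lebesgue_integral_def by (simp add: integral_bd_vol mult_ac)
  qed simp
  also have "\<dots> = (LINT x|bd_vol P. h x * w x)"
    unfolding set_lebesgue_integral_def integral_bd_vol
    by (rule Bochner_Integration.integral_cong) (auto simp: indicator_def)
  finally show ?thesis .
qed

text \<open>The constant family \<open>P\<close> has the zero measure as its weak derivative.\<close>

lemma zero_class_subset_W2:
  assumes P: "polytope P" "full_dim_convex_body P"
  shows "L2_class (bd_vol P) (\<lambda>x. 0) \<subseteq> W2 P"
proof
  fix w assume "w \<in> L2_class (bd_vol P) (\<lambda>x. 0)"
  then have w: "w \<in> L2 (bd_vol P)" "AE x in bd_vol P. w x = 0" by (auto simp: L2_class_def)
  have \<mu>: "(LINT x:A|bd_vol P. w x) = 0" for A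
    unfolding set_lebesgue_integral_def by (rule integral_eq_zero_AE) (use w(2) in auto)
  have si: "signed_integral (\<lambda>A. 0) (frontier P) h = 0" if "continuous_on UNIV h" for h
    using signed_integral_L2_density[OF P(1) w(1) _ that, of "\<lambda>A. 0"] \<mu> w(2)
    by (auto intro!: integral_eq_zero_AE)
  have "(\<lambda>A. 0) \<in> small_perturbations P"
    unfolding small_perturbations_def signed_measures_on_def signed_measure_def
      weakly_differentiable_def
    using P(2) si by (auto intro!: exI[of _ "\<lambda>t. P"] exI[of _ 0])
  then show "w \<in> W2 P" using w(1) \<mu> by (auto simp: W2_def)
qed

lemma right_derivative_at_local_max_nonpos:
  fixes u :: "real \<Rightarrow> real"
  assumes D: "(u has_real_derivative D) (at_right a)"
    and max: "\<forall>\<^sub>F t in at_right a. u t \<le> u a"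
  shows "D \<le> 0"
proof (rule tendsto_upperbound)
  show "((\<lambda>t. (u t - u a) / (t - a)) \<longlongrightarrow> D) (at_right a)"
    using D by (simp add: has_field_derivative_iff)
  show "\<forall>\<^sub>F t in at_right a. (u t - u a) / (t - a) \<le> 0"
    using max eventually_at_right_less[of a]
    by eventually_elim (simp add: divide_nonpos_pos)
qed simp

lemma weakly_differentiable_stays_near:
  fixes L :: "real \<Rightarrow> 'a::euclidean_space set"
  assumes L: "weakly_differentiable L" and \<epsilon>: "\<epsilon> > 0"
  shows "\<forall>\<^sub>F t in at_right 0. full_dim_convex_body (L t) \<and> hausdorff_dist (L t) (L 0) < \<epsilon>"
proof -
  have "\<forall>\<^sub>F t in at_right (0::real). t \<in> {0<..<1}" by (rule eventually_at_right_real) simp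
  then have K: "\<forall>\<^sub>F t in at_right 0. full_dim_convex_body (L t)"
    by (rule eventually_mono) (use L in \<open>auto simp: weakly_differentiable_def\<close>)
  have "full_dim_convex_body (L 0)" using L by (simp add: weakly_differentiable_def)
  moreover have "((\<lambda>t. LBINT x:L t. f x) \<longlongrightarrow> (LBINT x:L 0. f x)) (at_right 0)"
    if cf: "continuous_on UNIV f" for f :: "'a \<Rightarrow> real"
  proof -
    obtain D where "((\<lambda>t. LBINT x:L t. f x) has_real_derivative D) (at_right 0)"
      using L cf unfolding weakly_differentiable_def by blast
    then have "continuous (at_right 0) (\<lambda>t. LBINT x:L t. f x)" by (rule DERIV_continuous)
    then show ?thesis by (simp add: continuous_within)
  qed
  ultimately have "\<forall>\<^sub>F t in at_right 0. hausdorff_dist (L t) (L 0) < \<epsilon>"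
    using K \<epsilon> by (intro weak_convergence_imp_hausdorff_convergence)
  with K show ?thesis by (rule eventually_conj)
qed

lemma h_phi_continuous:
  assumes "\<And>i. continuous_on UNIV (f i)"
  shows "continuous_on UNIV (h_phi g f P)"
  unfolding h_phi_def[abs_def] using assms by (intro continuous_intros)

text \<open>The inner product is the right derivative at \<open>0\<close> of the functional along the family that
  realizes \<open>w\<close>; this family stays in the neighbourhood of \<open>P\<close> on which \<open>P\<close> is maximal.\<close>

lemma W2_inner_h_phi_nonpos:
  fixes f :: "'m::finite \<Rightarrow> 'a::euclidean_space \<Rightarrow> real"
  assumes f: "\<And>i. continuous_on UNIV (f i)"
    and g: "g differentiable (at (integrals f P))"
    and P: "polytope P" and max: "local_maximizer (phi_functional g f) P"
    and w: "w \<in> W2 P"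
  shows "(LINT x|bd_vol P. h_phi g f P x * w x) \<le> 0"
proof -
  let ?c = "\<lambda>i. partial_deriv i g (integrals f P)"
  from w obtain \<mu> where wL: "w \<in> L2 (bd_vol P)" and \<mu>: "\<mu> \<in> small_perturbations P"
    "\<And>A. A \<in> sets borel \<Longrightarrow> \<mu> A = (LINT x:A|bd_vol P. w x)" by (auto simp: W2_def)
  from \<mu>(1) obtain L where L: "weakly_differentiable L" "L 0 = P"
    and D: "\<And>f. continuous_on UNIV f \<Longrightarrow> ((\<lambda>t. LBINT x:L t. f x)
      has_real_derivative signed_integral \<mu> (frontier P) f) (at_right 0)"
    by (auto simp: small_perturbations_def)
  from max obtain \<epsilon> where \<epsilon>: "\<epsilon> > 0" "\<And>K. full_dim_convex_body K \<Longrightarrow> hausdorff_dist K P < \<epsilon> \<Longrightarrow>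
      phi_functional g f K \<le> phi_functional g f P" by (auto simp: local_maximizer_def)
  have fw: "integrable (bd_vol P) (\<lambda>x. f i x * w x)" for i
    by (rule L2_mult_integrable[OF continuous_in_L2_bd_vol[OF P f] wL])
  have "((\<lambda>t. phi_functional g f (L t)) has_real_derivative
      (\<Sum>i\<in>UNIV. ?c i * signed_integral \<mu> (frontier P) (f i))) (at_right 0)"
    using phi_functional_has_derivative[of g f L 0, OF _ D[OF f]] g L(2) by simp
  moreover have "\<forall>\<^sub>F t in at_right 0. phi_functional g f (L t) \<le> phi_functional g f (L 0)"
    using weakly_differentiable_stays_near[OF L(1) \<epsilon>(1)]
    by (rule eventually_mono) (use \<epsilon>(2) L(2) in auto)
  ultimately have "(\<Sum>i\<in>UNIV. ?c i * signed_integral \<mu> (frontier P) (f i)) \<le> 0"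
    by (rule right_derivative_at_local_max_nonpos)
  also have "(\<Sum>i\<in>UNIV. ?c i * signed_integral \<mu> (frontier P) (f i)) =
      (\<Sum>i\<in>UNIV. ?c i * (LINT x|bd_vol P. f i x * w x))"
    by (simp add: signed_integral_L2_density[OF P wL \<mu>(2) f])
  also have "\<dots> = (LINT x|bd_vol P. (\<Sum>i\<in>UNIV. ?c i * (f i x * w x)))"
    using fw by simp
  also have "\<dots> = (LINT x|bd_vol P. h_phi g f P x * w x)"
    by (simp add: h_phi_def sum_distrib_right mult.assoc)
  finally show ?thesis .
qed

theorem proposition7p2:
  fixes f :: "'m::finite \<Rightarrow> real ^ 'n \<Rightarrow> real"
    and g :: "real ^ 'm \<Rightarrow> real"
    and P :: "(real ^ 'n) set"
  assumes "\<And>i. continuous_on UNIV (f i)"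
    and "\<And>y. g differentiable (at y)"
    and "polytope P"
    and "full_dim_convex_body P"
    and "local_maximizer (phi_functional g f) P"
  shows "L2_proj (bd_vol P) (W2 P) (h_phi g f P) = L2_class (bd_vol P) (\<lambda>x. 0)"
proof (rule L2_proj_eq_zero_class)
  show "W2 P \<subseteq> L2 (bd_vol P)" by (auto simp: W2_def)
  show "L2_class (bd_vol P) (\<lambda>x. 0) \<subseteq> W2 P" using assms(3,4) by (rule zero_class_subset_W2)
  show "h_phi g f P \<in> L2 (bd_vol P)"
    using assms(3) h_phi_continuous[OF assms(1)] by (rule continuous_in_L2_bd_vol)
  show "(LINT x|bd_vol P. h_phi g f P x * q x) \<le> 0" if "q \<in> W2 P" for q
    using assms(1,2,3,5) that by (rule W2_inner_h_phi_nonpos)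
qed

end
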